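(* There exists a relatively open set of parameters $\tilde U$ in $(0,2\pi)\times[0,\infty)\times[0,\infty)$, containing $(\frac\pi2,0,0)$ in its closure, such that for $(\rho,\varepsilon,\tau)\in\tilde U$ the synchronous state $\psi=0$ and the splay state $\psi=\pi$ are both locally exponentially stable for the phase reduced equation $$\dot\psi=-2\varepsilon\cos(\rho-\omega\tau)\sin\psi+\varepsilon^2\Big(2\tau\sin\rho\sin(\rho-\omega\tau)\sin\psi-\Big[\tau+\tfrac1\alpha\sin^2(\rho-\omega\tau)\Big]\sin2\psi\Big)+\mathcal O(\varepsilon^3).$$
   Context: The parameters $\alpha,\beta,\gamma\neq0$ and $\delta=0$ are fixed. The displayed equation is the second-order phase reduction, for the phase difference $\psi=\phi_1-\phi_2$ (an angle modulo $2\pi$), of the two delay-coupled Stuart–Landau oscillators $\dot z_j=(\alpha+i\beta)z_j+(\gamma+i\delta)|z_j|^2z_j+\varepsilon e^{i\rho}(z_k(t-\tau)-z_j)$, $\{j,k\}=\{1,2\}$, $z_j\in\mathbb C$, with coupling strength $\varepsilon$, coupling rotation $\rho$ and time delay $\tau$. Each uncoupled oscillator has a periodic orbit of radius $\sqrt{-\alpha/\gamma}$ and angular frequency $\omega=\beta-\alpha\delta/\gamma$, so $\omega=\beta$ for $\delta=0$. The states $\psi=0$ (in-phase synchrony) and $\psi=\pi$ (anti-phase synchrony, or splay state) are equilibria of the phase reduced equation; such an equilibrium is exponentially stable if and only if its eigenvalue, i.e. the derivative of the right-hand side with respect to $\psi$ at the equilibrium, is negative.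
   Formalization: α>0 is assumed instead of α≠0, since for α<0 the eigenvalues at 0 and π have positive sum near (π/2,0,0), so the claim fails; O(ε³) is read as locally uniform in the parameters and as covering the ψ-derivative of a C¹ remainder. *)

theory Defs
  imports "HOL-Analysis.Analysis" "HOL-Library.Landau_Symbols"
begin

text \<open>Parameters are triples \<open>(\<rho>, \<epsilon>, \<tau>)\<close>: coupling rotation, coupling strength, time delay.\<close>

definition param_space :: "(real \<times> real \<times> real) set" where
  "param_space = {0<..<2 * pi} \<times> {0..} \<times> {0..}"

text \<open>
  The \<open>\<O>(\<epsilon>\<^sup>3)\<close> term of the phase reduced equation, as a function of the parameters and of
  the phase difference \<open>\<psi>\<close>. A phase reduction exists only for weak coupling, so everything is
  required only for small \<open>\<epsilon> > 0\<close>, locally uniformly in \<open>(\<rho>, \<tau>)\<close>. The order symbol is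
  understood in the \<open>C\<^sup>1\<close> sense with respect to \<open>\<psi>\<close>, uniformly in \<open>\<psi>\<close>: a bound on the values
  alone says nothing about eigenvalues. Since the remaining terms of the equation
  vanish at \<open>\<psi> = 0\<close> and \<open>\<psi> = \<pi>\<close>, these are equilibria iff the remainder vanishes there.
\<close>

definition weak_coupling :: "real \<Rightarrow> real \<Rightarrow> (real \<times> real \<times> real) filter" where
  "weak_coupling \<rho>\<^sub>0 \<tau>\<^sub>0 = at (\<rho>\<^sub>0, 0, \<tau>\<^sub>0) within ({0<..<2 * pi} \<times> {0<..} \<times> {0..})"

definition circle_C1 :: "(real \<Rightarrow> real) \<Rightarrow> bool" where
  "circle_C1 g \<longleftrightarrow> (\<forall>\<psi>. g (\<psi> + 2 * pi) = g \<psi>) \<and>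
     (\<forall>\<psi>. g field_differentiable at \<psi>) \<and> continuous_on UNIV (deriv g)"

definition third_order_remainder :: "(real \<times> real \<times> real \<Rightarrow> real \<Rightarrow> real) \<Rightarrow> bool" where
  "third_order_remainder R \<longleftrightarrow>
     (\<forall>\<rho>\<^sub>0\<in>{0<..<2 * pi}. \<forall>\<tau>\<^sub>0\<ge>0.
        (\<forall>\<^sub>F p in weak_coupling \<rho>\<^sub>0 \<tau>\<^sub>0. circle_C1 (R p) \<and> R p 0 = 0 \<and> R p pi = 0) \<and>
        (\<lambda>(p, \<psi>). R p \<psi>) \<in> O[weak_coupling \<rho>\<^sub>0 \<tau>\<^sub>0 \<times>\<^sub>F top](\<lambda>((\<rho>, \<epsilon>, \<tau>), \<psi>). \<epsilon> ^ 3) \<and>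
        (\<lambda>(p, \<psi>). deriv (R p) \<psi>) \<in> O[weak_coupling \<rho>\<^sub>0 \<tau>\<^sub>0 \<times>\<^sub>F top](\<lambda>((\<rho>, \<epsilon>, \<tau>), \<psi>). \<epsilon> ^ 3))"

fun phase_rhs ::
  "real \<Rightarrow> real \<Rightarrow> (real \<times> real \<times> real \<Rightarrow> real \<Rightarrow> real) \<Rightarrow> real \<times> real \<times> real \<Rightarrow> real \<Rightarrow> real"
where
  "phase_rhs \<alpha> \<omega> R (\<rho>, \<epsilon>, \<tau>) \<psi> =
     - 2 * \<epsilon> * cos (\<rho> - \<omega> * \<tau>) * sin \<psi>
     + \<epsilon>\<^sup>2 * (2 * \<tau> * sin \<rho> * sin (\<rho> - \<omega> * \<tau>) * sin \<psi>
             - (\<tau> + 1 / \<alpha> * (sin (\<rho> - \<omega> * \<tau>))\<^sup>2) * sin (2 * \<psi>))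
     + R (\<rho>, \<epsilon>, \<tau>) \<psi>"

text \<open>
  Angles are represented by real lifts. Solutions on every compact interval \<open>[0, T]\<close> are
  considered, so that no solution is excluded by a global existence requirement.
\<close>

definition ode_solution_on :: "(real \<Rightarrow> real) \<Rightarrow> real \<Rightarrow> (real \<Rightarrow> real) \<Rightarrow> bool" where
  "ode_solution_on f T x \<longleftrightarrow>
     (\<forall>t\<in>{0..T}. (x has_real_derivative f (x t)) (at t within {0..T}))"

definition locally_exponentially_stable :: "(real \<Rightarrow> real) \<Rightarrow> real \<Rightarrow> bool" where
  "locally_exponentially_stable f e \<longleftrightarrow> f e = 0 \<and>
     (\<exists>r>0. \<exists>M>0. \<exists>\<kappa>>0. \<forall>T\<ge>0. \<forall>x. ode_solution_on f T x \<and> \<bar>x 0 - e\<bar> < r \<longrightarrow>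
        (\<forall>t\<in>{0..T}. \<bar>x t - e\<bar> \<le> M * exp (- \<kappa> * t) * \<bar>x 0 - e\<bar>))"

end

theory Submission
  imports Defs
begin

text \<open>
  Put \<open>\<theta> = \<rho> - \<omega>\<tau>\<close>. Up to \<open>\<O>(\<epsilon>\<^sup>3)\<close> the eigenvalues at \<open>0\<close> and \<open>\<pi>\<close> are \<open>\<minusplus>a - b\<close> with
  \<open>a = 2\<epsilon> cos \<theta> - 2\<epsilon>\<^sup>2\<tau> sin \<rho> sin \<theta>\<close> and \<open>b = 2\<epsilon>\<^sup>2(\<tau> + sin\<^sup>2 \<theta> / \<alpha>)\<close>. At \<open>\<rho> = \<pi>/2\<close>, \<open>\<tau> = 0\<close> the
  first order vanishes: \<open>a = 0\<close>, while \<open>b = 2\<epsilon>\<^sup>2/\<alpha>\<close> dominates the cubic remainder \<open>C\<epsilon>\<^sup>3\<close>. Hence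
  the open condition \<open>\<bar>a\<bar> < b - C\<epsilon>\<^sup>3\<close> makes both eigenvalues negative and has \<open>(\<pi>/2, 0, 0)\<close> in
  its closure.
\<close>

lemma ode_solution_on_continuous_on:
  assumes "ode_solution_on f T x"
  shows "continuous_on {0..T} x"
  using assms unfolding ode_solution_on_def by (intro DERIV_continuous_on) blast

text \<open>The Lyapunov function \<open>(x t - e)\<^sup>2\<close>, weighted by
  \<open>exp (2 * \<kappa> * t)\<close>, cannot increase while the solution stays where
  \<open>contract\<close> applies. Nearness is asked only strictly between 0 and \<open>s\<close>,
  so that \<open>s\<close> may be a first exit time.\<close>

lemma ode_solution_on_contracting:
  assumes sol: "ode_solution_on f T x" and "s \<in> {0..T}" and "\<kappa> \<ge> 0"
    and contract: "\<And>y. \<bar>y - e\<bar> < r \<Longrightarrow> (y - e) * f y \<le> - \<kappa> * (y - e)\<^sup>2"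
    and near: "\<And>t. 0 < t \<Longrightarrow> t < s \<Longrightarrow> \<bar>x t - e\<bar> < r"
  shows "\<bar>x s - e\<bar> \<le> exp (- \<kappa> * s) * \<bar>x 0 - e\<bar>"
proof (cases "s = 0")
  case False
  with assms(2) have s: "0 < s" "s \<le> T" by auto
  define g where "g = (\<lambda>t. exp (2 * \<kappa> * t) * (x t - e)\<^sup>2)"
  have dx: "(x has_real_derivative f (x t)) (at t within {0..T})" if "t \<in> {0..T}" for t
    using sol that unfolding ode_solution_on_def by blast
  have "continuous_on {0..s} x"
    using ode_solution_on_continuous_on[OF sol] s by (auto intro: continuous_on_subset)
  then have cont: "continuous_on {0..s} g"
    unfolding g_def by (intro continuous_intros)
  \<comment> \<open>In the open interval the derivative within \<open>{0..T}\<close> is two-sided;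
    continuity takes care of the endpoints.\<close>
  have "g s \<le> g 0"
  proof (rule DERIV_nonpos_imp_decreasing_open[of 0 s g])
    fix t assume t: "0 < t" "t < s"
    then have "(x has_real_derivative f (x t)) (at t)"
      using dx[of t] s by (simp add: at_within_Icc_at)
    then have "(g has_real_derivative
        2 * exp (2 * \<kappa> * t) * (\<kappa> * (x t - e)\<^sup>2 + (x t - e) * f (x t))) (at t)"
      unfolding g_def
      by (auto intro!: derivative_eq_intros simp: algebra_simps power2_eq_square)
    moreover have "\<kappa> * (x t - e)\<^sup>2 + (x t - e) * f (x t) \<le> 0"
      using contract[OF near[OF t]] by simp
    ultimately show "\<exists>y. (g has_real_derivative y) (at t) \<and> y \<le> 0"
      by (meson mult_nonneg_nonpos exp_ge_zero zero_le_mult_iff zero_le_numeral)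
  qed (use s cont in auto)
  then have "exp (2 * \<kappa> * s) * (x s - e)\<^sup>2 \<le> (x 0 - e)\<^sup>2"
    by (simp add: g_def)
  then have "(exp (\<kappa> * s) * (x s - e))\<^sup>2 \<le> (x 0 - e)\<^sup>2"
    by (simp add: power_mult_distrib flip: exp_double) (simp add: mult.assoc)
  then have "exp (\<kappa> * s) * \<bar>x s - e\<bar> \<le> \<bar>x 0 - e\<bar>"
    by (simp add: abs_mult flip: abs_le_square_iff)
  then show ?thesis
    by (simp add: exp_minus field_simps)
qed simp

text \<open>The difference quotient at \<open>e\<close> tends to \<open>\<mu>\<close>, so on a small
  ball it stays below a negative constant, which is the contraction inequality. A first-exit
  argument then shows that solutions starting in the ball never leave it.\<close>

lemma locally_exponentially_stable_if_deriv_neg: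
  assumes fe: "f e = 0" and der: "(f has_real_derivative \<mu>) (at e)" and "\<mu> < 0"
  shows "locally_exponentially_stable f e"
proof -
  \<comment> \<open>Halving the rate leaves the strict gap \<open>\<mu> < - \<kappa>\<close> that
    the limit needs.\<close>
  define \<kappa> where "\<kappa> = - \<mu> / 2"
  have "\<kappa> > 0" "\<mu> < - \<kappa>" using \<open>\<mu> < 0\<close> by (auto simp: \<kappa>_def)
  have "((\<lambda>y. (f y - f e) / (y - e)) \<longlongrightarrow> \<mu>) (at e)"
    using der by (simp add: has_field_derivative_iff)
  then have "\<forall>\<^sub>F y in at e. (f y - f e) / (y - e) < - \<kappa>"
    using \<open>\<mu> < - \<kappa>\<close> by (rule order_tendstoD)
  then obtain r where "r > 0"
    and r: "\<And>y. y \<noteq> e \<Longrightarrow> dist y e < r \<Longrightarrow> (f y - f e) / (y - e) < - \<kappa>"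
    by (auto simp: eventually_at)
  have contract: "(y - e) * f y \<le> - \<kappa> * (y - e)\<^sup>2" if "\<bar>y - e\<bar> < r" for y
  proof (cases "y = e")
    case False
    then have "(y - e) * f y = (f y - f e) / (y - e) * (y - e)\<^sup>2"
      by (simp add: fe power2_eq_square)
    also have "\<dots> \<le> - \<kappa> * (y - e)\<^sup>2"
      using r[OF False] that by (intro mult_right_mono) (auto simp: dist_real_def)
    finally show ?thesis .
  qed simp
  have "\<bar>x t - e\<bar> \<le> 1 * exp (- \<kappa> * t) * \<bar>x 0 - e\<bar>"
    if sol: "ode_solution_on f T x" and x0: "\<bar>x 0 - e\<bar> < r" and t: "t \<in> {0..T}" for T x t
  proof -
    have near: "\<bar>x u - e\<bar> < r" if "u \<in> {0..T}" for u
    proof (rule ccontr)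
      \<comment> \<open>\<open>E\<close> is the set of times spent outside the ball. It is closed,
        so \<open>Inf E\<close> is a first exit time; contraction up to then keeps the distance
        below its initial value, hence below \<open>r\<close>, a contradiction.\<close>
      define E where "E = {0..T} \<inter> (\<lambda>u. \<bar>x u - e\<bar>) -` {r..}"
      assume "\<not> \<bar>x u - e\<bar> < r"
      then have "E \<noteq> {}" using that by (auto simp: E_def)
      have "continuous_on {0..T} x"
        using sol by (rule ode_solution_on_continuous_on)
      then have "closed E"
        unfolding E_def by (intro continuous_closed_preimage continuous_intros) auto
      moreover have bdd: "bdd_below E" unfolding E_def by auto
      ultimately have E: "Inf E \<in> E"
        using \<open>E \<noteq> {}\<close> by (intro closed_contains_Inf)
      have "\<bar>x v - e\<bar> < r" if "0 < v" "v < Inf E" for v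
        using that E cInf_lower[OF _ bdd, of v] by (force simp: E_def)
      then have "\<bar>x (Inf E) - e\<bar> \<le> exp (- \<kappa> * Inf E) * \<bar>x 0 - e\<bar>"
        using E \<open>\<kappa> > 0\<close>
        by (intro ode_solution_on_contracting[OF sol _ _ contract]) (auto simp: E_def)
      also have "\<dots> \<le> 1 * \<bar>x 0 - e\<bar>"
        using E \<open>\<kappa> > 0\<close> by (intro mult_right_mono) (auto simp: E_def)
      finally show False using x0 E by (auto simp: E_def)
    qed
    show ?thesis
      using ode_solution_on_contracting[OF sol t _ contract] near t \<open>\<kappa> > 0\<close> by simp
  qed
  with fe \<open>r > 0\<close> \<open>\<kappa> > 0\<close> show ?thesis
    unfolding locally_exponentially_stable_def
    by (intro conjI exI[of _ r] exI[of _ "1::real"] exI[of _ \<kappa>]) auto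
qed

text \<open>A property holds eventually for \<open>top\<close> only if it holds everywhere, so the
  product with \<open>top\<close> encodes uniformity in the second variable, here the phase
  \<open>\<psi>\<close>.\<close>

lemma eventually_prod_top:
  "eventually P (F \<times>\<^sub>F top) \<longleftrightarrow> (\<forall>\<^sub>F x in F. \<forall>y. P (x, y))"
proof
  assume "eventually P (F \<times>\<^sub>F top)"
  then obtain Q Q' where "eventually Q F" "\<forall>y. Q' y" "\<And>x y. Q x \<Longrightarrow> Q' y \<Longrightarrow> P (x, y)"
    unfolding eventually_prod_filter eventually_top by blast
  then show "\<forall>\<^sub>F x in F. \<forall>y. P (x, y)"
    by (auto elim: eventually_mono)
next
  assume "\<forall>\<^sub>F x in F. \<forall>y. P (x, y)"
  then show "eventually P (F \<times>\<^sub>F top)"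
    unfolding eventually_prod_filter eventually_top
    by (intro exI[of _ "\<lambda>x. \<forall>y. P (x, y)"] exI[of _ "\<lambda>_. True"]) simp
qed

text \<open>Turns the order symbol into one constant \<open>C\<close> on an explicit ball. As
  \<open>C\<close> does not depend on \<open>\<psi>\<close>, it serves both equilibria at
  once.\<close>

lemma third_order_remainder_local_bound:
  assumes "third_order_remainder R" "\<rho>\<^sub>0 \<in> {0<..<2 * pi}" "\<tau>\<^sub>0 \<ge> 0"
  obtains C d where "C > 0" "d > 0"
    "\<And>\<rho> \<epsilon> \<tau> \<psi>. \<rho> \<in> {0<..<2 * pi} \<Longrightarrow> \<epsilon> > 0 \<Longrightarrow> \<tau> \<ge> 0 \<Longrightarrow> dist (\<rho>, \<epsilon>, \<tau>) (\<rho>\<^sub>0, 0, \<tau>\<^sub>0) < d \<Longrightarrow>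
       circle_C1 (R (\<rho>, \<epsilon>, \<tau>)) \<and> R (\<rho>, \<epsilon>, \<tau>) 0 = 0 \<and> R (\<rho>, \<epsilon>, \<tau>) pi = 0 \<and>
       \<bar>deriv (R (\<rho>, \<epsilon>, \<tau>)) \<psi>\<bar> \<le> C * \<epsilon> ^ 3"
proof -
  define P where "P = (\<lambda>p. circle_C1 (R p) \<and> R p 0 = 0 \<and> R p pi = 0)"
  from assms have P: "\<forall>\<^sub>F p in weak_coupling \<rho>\<^sub>0 \<tau>\<^sub>0. P p"
    and O: "(\<lambda>(p, \<psi>). deriv (R p) \<psi>)
      \<in> O[weak_coupling \<rho>\<^sub>0 \<tau>\<^sub>0 \<times>\<^sub>F top](\<lambda>((\<rho>, \<epsilon>, \<tau>), \<psi>). \<epsilon> ^ 3)"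
    unfolding third_order_remainder_def P_def by blast+
  from O obtain C where "C > 0" and
    "\<forall>\<^sub>F q in weak_coupling \<rho>\<^sub>0 \<tau>\<^sub>0 \<times>\<^sub>F top.
       norm ((\<lambda>(p, \<psi>). deriv (R p) \<psi>) q) \<le> C * norm ((\<lambda>((\<rho>, \<epsilon>, \<tau>), \<psi>). \<epsilon> ^ 3) q)"
    by (elim landau_o.bigE)
  then have "\<forall>\<^sub>F p in weak_coupling \<rho>\<^sub>0 \<tau>\<^sub>0. \<forall>\<psi>. \<bar>deriv (R p) \<psi>\<bar> \<le> C * \<bar>fst (snd p) ^ 3\<bar>"
    by (simp add: eventually_prod_top case_prod_unfold)
  with P have "\<forall>\<^sub>F p in weak_coupling \<rho>\<^sub>0 \<tau>\<^sub>0.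
      P p \<and> (\<forall>\<psi>. \<bar>deriv (R p) \<psi>\<bar> \<le> C * \<bar>fst (snd p) ^ 3\<bar>)"
    by (rule eventually_conj)
  then obtain d where "d > 0" and
    d: "\<And>p. p \<in> {0<..<2 * pi} \<times> {0<..} \<times> {0..} \<Longrightarrow> p \<noteq> (\<rho>\<^sub>0, 0, \<tau>\<^sub>0) \<Longrightarrow> dist p (\<rho>\<^sub>0, 0, \<tau>\<^sub>0) < d \<Longrightarrow>
      P p \<and> (\<forall>\<psi>. \<bar>deriv (R p) \<psi>\<bar> \<le> C * \<bar>fst (snd p) ^ 3\<bar>)"
    unfolding weak_coupling_def eventually_at by blast
  show thesis
  proof (rule that[OF \<open>C > 0\<close> \<open>d > 0\<close>])
    fix \<rho> \<epsilon> \<tau> \<psi> :: real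
    \<comment> \<open>Positivity of \<open>\<epsilon>\<close> separates the point from the centre of
      the ball and removes the absolute value around \<open>\<epsilon> ^ 3\<close>.\<close>
    assume "\<rho> \<in> {0<..<2 * pi}" "\<epsilon> > 0" "\<tau> \<ge> 0" "dist (\<rho>, \<epsilon>, \<tau>) (\<rho>\<^sub>0, 0, \<tau>\<^sub>0) < d"
    with d[of "(\<rho>, \<epsilon>, \<tau>)"]
    show "circle_C1 (R (\<rho>, \<epsilon>, \<tau>)) \<and> R (\<rho>, \<epsilon>, \<tau>) 0 = 0 \<and> R (\<rho>, \<epsilon>, \<tau>) pi = 0 \<and>
       \<bar>deriv (R (\<rho>, \<epsilon>, \<tau>)) \<psi>\<bar> \<le> C * \<epsilon> ^ 3"
      by (auto simp: P_def)
  qed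
qed

text \<open>From \<open>\<psi> = 0\<close> to \<open>\<psi> = pi\<close> the factor
  \<open>cos \<psi>\<close> changes sign while \<open>cos (2 * \<psi>)\<close> stays 1; hence the
  eigenvalues differ, apart from the remainder, only in the sign of the first harmonic.\<close>

lemma phase_rhs_has_derivative:
  assumes "\<alpha> \<noteq> 0" "circle_C1 (R (\<rho>, \<epsilon>, \<tau>))"
  shows "(phase_rhs \<alpha> \<omega> R (\<rho>, \<epsilon>, \<tau>) has_real_derivative
     - 2 * \<epsilon> * cos (\<rho> - \<omega> * \<tau>) * cos \<psi>
     + \<epsilon>\<^sup>2 * (2 * \<tau> * sin \<rho> * sin (\<rho> - \<omega> * \<tau>) * cos \<psi>
             - (\<tau> + 1 / \<alpha> * (sin (\<rho> - \<omega> * \<tau>))\<^sup>2) * (2 * cos (2 * \<psi>)))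
     + deriv (R (\<rho>, \<epsilon>, \<tau>)) \<psi>) (at \<psi>)"
proof -
  have "(R (\<rho>, \<epsilon>, \<tau>) has_real_derivative deriv (R (\<rho>, \<epsilon>, \<tau>)) \<psi>) (at \<psi>)"
    using assms(2) by (simp add: circle_C1_def DERIV_deriv_iff_field_differentiable)
  moreover have rhs: "phase_rhs \<alpha> \<omega> R (\<rho>, \<epsilon>, \<tau>) = (\<lambda>\<psi>.
      - 2 * \<epsilon> * cos (\<rho> - \<omega> * \<tau>) * sin \<psi>
      + \<epsilon>\<^sup>2 * (2 * \<tau> * sin \<rho> * sin (\<rho> - \<omega> * \<tau>) * sin \<psi>
              - (\<tau> + 1 / \<alpha> * (sin (\<rho> - \<omega> * \<tau>))\<^sup>2) * sin (2 * \<psi>))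
      + R (\<rho>, \<epsilon>, \<tau>) \<psi>)"
    by (simp add: fun_eq_iff)
  ultimately show ?thesis
    unfolding rhs
    using \<open>\<alpha> \<noteq> 0\<close> by (auto intro!: derivative_eq_intros simp: algebra_simps)
qed

theorem corollary4p2:
  fixes \<alpha> \<beta> \<gamma> \<delta> \<omega> :: real
    and R :: "real \<times> real \<times> real \<Rightarrow> real \<Rightarrow> real"
  assumes "\<alpha> > 0" and "\<beta> \<noteq> 0" and "\<gamma> \<noteq> 0" and "\<delta> = 0"
    and "\<omega> = \<beta> - \<alpha> * \<delta> / \<gamma>"
    and "third_order_remainder R"
  shows "\<exists>U. openin (top_of_set param_space) U \<and>
           (pi / 2, 0, 0) \<in> closure U \<and>
           (\<forall>p\<in>U. locally_exponentially_stable (phase_rhs \<alpha> \<omega> R p) 0 \<and>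
                   locally_exponentially_stable (phase_rhs \<alpha> \<omega> R p) pi)"
proof -
  have "pi / 2 \<in> {0<..<2 * pi}" using pi_gt_zero by auto
  then obtain C d where "C > 0" "d > 0" and rem:
    "\<And>\<rho> \<epsilon> \<tau> \<psi>. \<rho> \<in> {0<..<2 * pi} \<Longrightarrow> \<epsilon> > 0 \<Longrightarrow> \<tau> \<ge> 0 \<Longrightarrow> dist (\<rho>, \<epsilon>, \<tau>) (pi / 2, 0, 0) < d \<Longrightarrow>
       circle_C1 (R (\<rho>, \<epsilon>, \<tau>)) \<and> R (\<rho>, \<epsilon>, \<tau>) 0 = 0 \<and> R (\<rho>, \<epsilon>, \<tau>) pi = 0 \<and>
       \<bar>deriv (R (\<rho>, \<epsilon>, \<tau>)) \<psi>\<bar> \<le> C * \<epsilon> ^ 3"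
    using third_order_remainder_local_bound[OF assms(6), of "pi / 2" 0] by (metis order_refl)
  \<comment> \<open>\<open>- A\<close> is the coefficient of \<open>sin \<psi>\<close>;
    \<open>B\<close> is the second-harmonic damping, already reduced by the worst case of the
    remainder's derivative.\<close>
  define A where "A = (\<lambda>(\<rho>, \<epsilon>, \<tau>).
    2 * \<epsilon> * cos (\<rho> - \<omega> * \<tau>) - \<epsilon>\<^sup>2 * (2 * \<tau> * sin \<rho> * sin (\<rho> - \<omega> * \<tau>)))"
  define B where "B = (\<lambda>(\<rho>::real, \<epsilon>, \<tau>).
    2 * \<epsilon>\<^sup>2 * (\<tau> + 1 / \<alpha> * (sin (\<rho> - \<omega> * \<tau>))\<^sup>2) - C * \<epsilon> ^ 3)"
  \<comment> \<open>Strict inequalities between continuous functions make \<open>V\<close> open in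
    the whole space; \<open>\<epsilon> > 0\<close> is imposed because the remainder is controlled
    only there.\<close>
  define V where "V = ball (pi / 2, 0, 0) d \<inter> {p. 0 < fst (snd p)} \<inter> {p. \<bar>A p\<bar> < B p}"
  define U where "U = param_space \<inter> V"
  have "open V"
    unfolding V_def A_def B_def case_prod_unfold
    by (intro open_Int open_ball open_Collect_less continuous_intros)
  then have "openin (top_of_set param_space) U"
    unfolding U_def by (simp add: openin_open_Int)
  moreover have "(pi / 2, 0, 0) \<in> closure U"
  proof (rule closure_sequential[THEN iffD2], intro exI conjI allI)
    \<comment> \<open>On the segment \<open>\<rho> = pi / 2\<close>, \<open>\<tau> = 0\<close> one
      has \<open>A = 0\<close> and
      \<open>B = \<epsilon>\<^sup>2 * (2 / \<alpha> - C * \<epsilon>)\<close>, positive for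
      \<open>0 < \<epsilon> < 2 / (\<alpha> * C)\<close>. Halving the minimum makes both bounds
      strict.\<close>
    define s where "s = min d (2 / (\<alpha> * C)) / 2"
    have s: "0 < s" "s < d" "\<alpha> * C * s < 2"
      using \<open>\<alpha> > 0\<close> \<open>C > 0\<close> \<open>d > 0\<close> by (auto simp: s_def min_def field_simps)
    let ?\<epsilon> = "\<lambda>n. s / real (Suc n)"
    fix n
    have e: "0 < ?\<epsilon> n" "?\<epsilon> n \<le> s"
      using s by (auto simp: field_simps)
    have "\<alpha> * C * ?\<epsilon> n \<le> \<alpha> * C * s"
      using e(2) \<open>\<alpha> > 0\<close> \<open>C > 0\<close> by (intro mult_left_mono) auto
    with s have "C * ?\<epsilon> n < 2 / \<alpha>"
      using \<open>\<alpha> > 0\<close> by (simp add: field_simps)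
    then have "(?\<epsilon> n)\<^sup>2 * (C * ?\<epsilon> n) < (?\<epsilon> n)\<^sup>2 * (2 / \<alpha>)"
      using e(1) by (intro mult_strict_left_mono) auto
    then have "\<bar>A (pi / 2, ?\<epsilon> n, 0)\<bar> < B (pi / 2, ?\<epsilon> n, 0)"
      by (simp add: A_def B_def power2_eq_square power3_eq_cube mult_ac)
    moreover have "dist (pi / 2, 0, 0) (pi / 2, ?\<epsilon> n, 0::real) < d"
      using e s by (simp add: dist_Pair_Pair dist_real_def)
    ultimately show "(pi / 2, ?\<epsilon> n, 0) \<in> U"
      using e(1) pi_gt_zero by (auto simp: U_def V_def param_space_def)
  next
    \<comment> \<open>This is the sequence just placed in \<open>U\<close>, with \<open>s\<close>
      written out.\<close>
    show "(\<lambda>n. (pi / 2, min d (2 / (\<alpha> * C)) / 2 / real (Suc n), 0)) \<longlonglongrightarrow> (pi / 2, 0, 0::real)"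
      by (intro tendsto_Pair tendsto_const LIMSEQ_Suc[OF lim_const_over_n])
  qed
  moreover have "locally_exponentially_stable (phase_rhs \<alpha> \<omega> R p) 0 \<and>
      locally_exponentially_stable (phase_rhs \<alpha> \<omega> R p) pi" if "p \<in> U" for p
  proof -
    obtain \<rho> \<epsilon> \<tau> where p: "p = (\<rho>, \<epsilon>, \<tau>)" by (cases p) auto
    from that have "\<rho> \<in> {0<..<2 * pi}" "\<epsilon> > 0" "\<tau> \<ge> 0" "dist (\<rho>, \<epsilon>, \<tau>) (pi / 2, 0, 0) < d"
      and AB: "\<bar>A (\<rho>, \<epsilon>, \<tau>)\<bar> < B (\<rho>, \<epsilon>, \<tau>)"
      by (auto simp: p U_def V_def param_space_def dist_commute)
    note R = rem[OF this(1-4)]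
    note der = phase_rhs_has_derivative[of \<alpha> R \<rho> \<epsilon> \<tau> \<omega>]
    have "deriv (R (\<rho>, \<epsilon>, \<tau>)) 0 \<le> C * \<epsilon> ^ 3" "deriv (R (\<rho>, \<epsilon>, \<tau>)) pi \<le> C * \<epsilon> ^ 3"
      using R[of 0] R[of pi] by linarith+
    \<comment> \<open>The eigenvalues are at most \<open>- A - B\<close> at 0 and
      \<open>A - B\<close> at \<open>pi\<close>, so each of the two inequalities settles one
      equilibrium.\<close>
    moreover have "A (\<rho>, \<epsilon>, \<tau>) < B (\<rho>, \<epsilon>, \<tau>)" "- A (\<rho>, \<epsilon>, \<tau>) < B (\<rho>, \<epsilon>, \<tau>)"
      using AB by linarith+
    ultimately show ?thesis
      using R \<open>\<alpha> > 0\<close> unfolding p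
      by (intro conjI locally_exponentially_stable_if_deriv_neg[OF _ der])
        (auto simp: A_def B_def algebra_simps)
  qed
  ultimately show ?thesis by blast
qed

end
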